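(* Suppose the Pearson equations $\sigma(x)\tilde w_1'(x)=q_1(x)\tilde w_1(x)$ and $\sigma(x)\tilde w_2'(x)=q_2(x)\tilde w_2(x)$ hold on $\Delta$, where $\sigma,q_1,q_2$ are polynomials and $\sigma\tilde w_1=\sigma\tilde w_2=0$ at the boundary $\partial\Delta$ of the support. Then the moment matrix $g$ satisfies $$\sigma(\Lambda)\mathscr D g=-g\big(\mathscr D_1\sigma(\Lambda_1)+q_1(\Lambda_1)+\mathscr D_2\sigma(\Lambda_2)+q_2(\Lambda_2)\big)^\top .$$
   Context: Let $\Delta\subset\mathbb R$ be an interval, $\mathrm d\mu=v(x)\,\mathrm dx$ on $\Delta$, $w_1,w_2$ weights, and $\tilde w_a=w_av$, $a\in\{1,2\}$, with all moments finite. (At an infinite endpoint of $\Delta$, the boundary condition means that $x^k\sigma\tilde w_a\to0$ for all $k$.) All vectors and matrices are semi-infinite, indexed by $0,1,2,\dots$. Put $X(x)=(1,x,x^2,\dots)^\top$, $X_1(x)=(1,0,x,0,x^2,0,\dots)^\top$, $X_2(x)=(0,1,0,x,0,x^2,\dots)^\top$. The moment matrix is $g=\int_\Delta X(x)\big(X_1(x)\tilde w_1(x)+X_2(x)\tilde w_2(x)\big)^\top\mathrm dx$. $\Lambda$ is the shift matrix with ones on the first superdiagonal and zeros elsewhere; $\Pi_1=\operatorname{diag}(1,0,1,0,\dots)$, $\Pi_2=\operatorname{diag}(0,1,0,1,\dots)$, $\Lambda_1=\Pi_1\Lambda^2$, $\Lambda_2=\Pi_2\Lambda^2$. For a polynomial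 $q(x)=\sum_kq_kx^k$, $q(\Lambda)=\sum_k q_k\Lambda^k$ with $\Lambda^0=I$, while $q(\Lambda_a)=\sum_kq_k\Lambda_a^k$ with the convention $\Lambda_a^0:=\Pi_a$, $a\in\{1,2\}$. Derivation matrices: $\mathscr D=\Lambda^\top\operatorname{diag}(1,2,3,\dots)$, $\mathscr D_1=(\Lambda^\top)^2\operatorname{diag}(1,0,2,0,3,0,\dots)$, $\mathscr D_2=(\Lambda^\top)^2\operatorname{diag}(0,1,0,2,0,3,\dots)$, so that $X'=\mathscr DX$, $X_1'=\mathscr D_1X_1$, $X_2'=\mathscr D_2X_2$, $\mathscr D_1X_2=\mathscr D_2X_1=\mathbf 0$. *)

theory Defs
  imports "HOL-Analysis.Analysis" "HOL-Computational_Algebra.Polynomial"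
    "HOL-Library.Function_Algebras"
begin

text \<open>
  Semi-infinite vectors and matrices are functions on indices \<open>0, 1, 2, \<dots>\<close>; sums, negatives and
  finite linear combinations of matrices are the pointwise ones on functions.
\<close>

type_synonym svec = "nat \<Rightarrow> real"
type_synonym smat = "nat \<Rightarrow> nat \<Rightarrow> real"

text \<open>
  In every product below, for each row index of the left factor or each column index of the right
  factor only finitely many entries are nonzero, so each of the series is a finite sum.
\<close>

definition smat_mult :: "smat \<Rightarrow> smat \<Rightarrow> smat"  (infixl "\<odot>" 70) where
  "A \<odot> B = (\<lambda>i j. \<Sum>k. A i k * B k j)"

definition smat_transpose :: "smat \<Rightarrow> smat" where
  "smat_transpose A = (\<lambda>i j. A j i)"

definition smat_diag :: "svec \<Rightarrow> smat" where
  "smat_diag d = (\<lambda>i j. if i = j then d i else 0)"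

definition smat_id :: smat where
  "smat_id = smat_diag (\<lambda>i. 1)"

definition smat_scale :: "real \<Rightarrow> smat \<Rightarrow> smat" where
  "smat_scale c A = (\<lambda>i j. c * A i j)"

primrec smat_power :: "smat \<Rightarrow> nat \<Rightarrow> smat" where
  "smat_power A 0 = smat_id"
| "smat_power A (Suc k) = A \<odot> smat_power A k"

text \<open>Evaluation of a polynomial at \<open>A\<close>, with \<open>P\<close> playing the role of the zeroth power of \<open>A\<close>.\<close>

definition smat_poly :: "smat \<Rightarrow> real poly \<Rightarrow> smat \<Rightarrow> smat" where
  "smat_poly P q A =
     (\<Sum>k\<le>degree q. smat_scale (coeff q k) (if k = 0 then P else smat_power A k))"

definition Lam :: smat where
  "Lam = (\<lambda>i j. if j = Suc i then 1 else 0)"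

definition Proj1 :: smat where
  "Proj1 = smat_diag (\<lambda>i. if even i then 1 else 0)"

definition Proj2 :: smat where
  "Proj2 = smat_diag (\<lambda>i. if odd i then 1 else 0)"

definition Lam1 :: smat where
  "Lam1 = Proj1 \<odot> smat_power Lam 2"

definition Lam2 :: smat where
  "Lam2 = Proj2 \<odot> smat_power Lam 2"

definition Der :: smat where
  "Der = smat_transpose Lam \<odot> smat_diag (\<lambda>i. real (i + 1))"

definition Der1 :: smat where
  "Der1 = smat_power (smat_transpose Lam) 2
            \<odot> smat_diag (\<lambda>i. if even i then real (i div 2 + 1) else 0)"

definition Der2 :: smat where
  "Der2 = smat_power (smat_transpose Lam) 2
            \<odot> smat_diag (\<lambda>i. if odd i then real (i div 2 + 1) else 0)"

definition Xvec :: "real \<Rightarrow> svec" where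
  "Xvec x = (\<lambda>i. x ^ i)"

definition X1vec :: "real \<Rightarrow> svec" where
  "X1vec x = (\<lambda>i. if even i then x ^ (i div 2) else 0)"

definition X2vec :: "real \<Rightarrow> svec" where
  "X2vec x = (\<lambda>i. if odd i then x ^ (i div 2) else 0)"

definition moment_matrix :: "real set \<Rightarrow> (real \<Rightarrow> real) \<Rightarrow> (real \<Rightarrow> real) \<Rightarrow> smat" where
  "moment_matrix \<Delta> u1 u2 =
     (\<lambda>i j. LINT x:\<Delta>|lborel. Xvec x i * (X1vec x j * u1 x + X2vec x j * u2 x))"

definition finite_moments :: "real set \<Rightarrow> (real \<Rightarrow> real) \<Rightarrow> bool" where
  "finite_moments \<Delta> u \<longleftrightarrow> (\<forall>k. set_integrable lborel \<Delta> (\<lambda>x. x ^ k * u x))"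

text \<open>
  The equation is required at interior points only, since a weight may be singular at an endpoint
  that belongs to \<open>\<Delta>\<close>, as \<open>(1 - x) powr \<alpha>\<close> is at \<open>1\<close> for \<open>-1 < \<alpha> < 0\<close>.
\<close>

definition pearson :: "real set \<Rightarrow> real poly \<Rightarrow> real poly \<Rightarrow> (real \<Rightarrow> real) \<Rightarrow> bool" where
  "pearson \<Delta> \<sigma> q u \<longleftrightarrow>
     (\<forall>x\<in>interior \<Delta>. u field_differentiable at x \<and> poly \<sigma> x * deriv u x = poly q x * u x)"

text \<open>
  Vanishing at a finite endpoint is a one-sided limit: the value of a density at an endpoint is
  immaterial, and is meaningless when the density is singular there. An infinite endpoint belongs
  to the boundary as well.
\<close>

definition vanishes_at_boundary :: "real set \<Rightarrow> (real \<Rightarrow> real) \<Rightarrow> bool" where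
  "vanishes_at_boundary \<Delta> f \<longleftrightarrow>
     (\<forall>c\<in>frontier \<Delta>. (f \<longlongrightarrow> 0) (at c within \<Delta>)) \<and>
     (\<not> bdd_above \<Delta> \<longrightarrow> (\<forall>k::nat. ((\<lambda>x. x ^ k * f x) \<longlongrightarrow> 0) at_top)) \<and>
     (\<not> bdd_below \<Delta> \<longrightarrow> (\<forall>k::nat. ((\<lambda>x. x ^ k * f x) \<longlongrightarrow> 0) at_bot))"

end

theory Submission imports Defs begin

text \<open>
  Integrating the derivative of \<open>x ^ m * \<sigma> * u\<close> over \<open>\<Delta>\<close> gives \<open>0\<close>, because the boundary terms vanish;
  the Pearson equation turns this into a linear recurrence between the moments of \<open>u\<close>. Entry
  \<open>(i, j)\<close> of the matrix identity is this recurrence with \<open>m = i + j div 2\<close>, for the first weight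
  if \<open>j\<close> is even and for the second one if \<open>j\<close> is odd.
\<close>

section \<open>Products of semi-infinite matrices with finite rows\<close>

lemma smat_mult_eq_sum:
  assumes "finite N" "\<And>l. l \<notin> N \<Longrightarrow> A i l = 0"
  shows "(A \<odot> B) i j = (\<Sum>l\<in>N. A i l * B l j)"
  unfolding smat_mult_def by (rule suminf_finite) (use assms in auto)

lemma smat_mult_single_row:
  assumes "\<And>l. A i l = (if l = h then c else 0)"
  shows "(A \<odot> B) i j = c * B h j"
  by (subst smat_mult_eq_sum[of "{h}"]) (use assms in auto)

text \<open>Finiteness is tracked on left factors only: the moment matrix may have no zero entry at
  all, so it can only stand as the rightmost factor.\<close>

definition row_finite :: "smat \<Rightarrow> bool" where
  "row_finite A \<longleftrightarrow> (\<forall>i. finite {l. A i l \<noteq> 0})"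

lemma row_finiteI:
  assumes "\<And>i. finite (N i)" "\<And>i l. l \<notin> N i \<Longrightarrow> A i l = 0"
  shows "row_finite A"
  unfolding row_finite_def using assms by (metis (mono_tags, lifting) finite_subset mem_Collect_eq subsetI)

lemma row_finite_single_row:
  assumes "\<And>i l. A i l = (if l = h i then c i else 0)"
  shows "row_finite A"
  by (rule row_finiteI[of "\<lambda>i. {h i}"]) (use assms in auto)

lemma row_finite_add:
  assumes "row_finite A" "row_finite B"
  shows "row_finite (A + B)"
  by (rule row_finiteI[of "\<lambda>i. {l. A i l \<noteq> 0} \<union> {l. B i l \<noteq> 0}"])
    (use assms in \<open>auto simp: row_finite_def\<close>)

lemma row_finite_mult:
  assumes "row_finite A" "row_finite B"
  shows "row_finite (A \<odot> B)"
proof (rule row_finiteI)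
  fix i l
  show "finite (\<Union>k\<in>{k. A i k \<noteq> 0}. {l. B k l \<noteq> 0})"
    using assms by (auto simp: row_finite_def)
  assume "l \<notin> (\<Union>k\<in>{k. A i k \<noteq> 0}. {l. B k l \<noteq> 0})"
  then have "(\<lambda>k. A i k * B k l) = (\<lambda>k. 0)"
    by fastforce
  then show "(A \<odot> B) i l = 0"
    by (simp only: smat_mult_def suminf_zero)
qed

text \<open>Row \<open>i\<close> of \<open>A\<close> meets finitely many rows of \<open>B\<close>,
  and these together meet finitely many rows of \<open>C\<close>. Both iterated series are thus
  finite sums that may be exchanged, whatever \<open>C\<close> is.\<close>

lemma smat_mult_assoc:
  assumes "row_finite A" "row_finite B"
  shows "A \<odot> B \<odot> C = A \<odot> (B \<odot> C)"
proof (intro ext)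
  fix i j
  define K where "K = {k. A i k \<noteq> 0}"
  define L where "L = (\<Union>k\<in>K. {l. B k l \<noteq> 0})"
  have K: "finite K" "\<And>k. k \<notin> K \<Longrightarrow> A i k = 0"
    using assms by (auto simp: K_def row_finite_def)
  have L: "finite L" "\<And>k l. k \<in> K \<Longrightarrow> l \<notin> L \<Longrightarrow> B k l = 0"
    using assms K(1) by (auto simp: L_def row_finite_def)
  have AB: "(A \<odot> B) i l = (\<Sum>k\<in>K. A i k * B k l)" for l
    by (rule smat_mult_eq_sum) (use K in auto)
  have "(A \<odot> B \<odot> C) i j = (\<Sum>l\<in>L. (A \<odot> B) i l * C l j)"
    by (rule smat_mult_eq_sum) (use L in \<open>auto simp: AB intro!: sum.neutral\<close>)
  also have "\<dots> = (\<Sum>k\<in>K. A i k * (\<Sum>l\<in>L. B k l * C l j))"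
    by (simp add: AB sum_distrib_left sum_distrib_right sum.swap[of _ K L] mult.assoc)
  also have "\<dots> = (\<Sum>k\<in>K. A i k * (B \<odot> C) k j)"
    by (intro sum.cong refl arg_cong2[of _ _ _ _ "(*)"] smat_mult_eq_sum[symmetric]) (use L in auto)
  also have "\<dots> = (A \<odot> (B \<odot> C)) i j"
    by (rule smat_mult_eq_sum[symmetric]) (use K in auto)
  finally show "(A \<odot> B \<odot> C) i j = (A \<odot> (B \<odot> C)) i j" .
qed

lemma smat_mult_add_left:
  assumes "row_finite A" "row_finite B"
  shows "(A + B) \<odot> C = A \<odot> C + B \<odot> C"
proof (intro ext)
  fix i j
  let ?N = "{l. A i l \<noteq> 0} \<union> {l. B i l \<noteq> 0}"
  have N: "finite ?N"
    using assms by (simp add: row_finite_def)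
  have "((A + B) \<odot> C) i j = (\<Sum>l\<in>?N. (A + B) i l * C l j)"
    "(A \<odot> C) i j = (\<Sum>l\<in>?N. A i l * C l j)" "(B \<odot> C) i j = (\<Sum>l\<in>?N. B i l * C l j)"
    by (rule smat_mult_eq_sum[OF N]; simp)+
  then show "((A + B) \<odot> C) i j = (A \<odot> C + B \<odot> C) i j"
    by (simp add: distrib_right sum.distrib)
qed

text \<open>Both sides are the same series term by term. This turns a product with \<open>g\<close>
  on the left into row-finite matrices acting on the transpose of \<open>g\<close>, where
  associativity and distributivity are available.\<close>

lemma smat_mult_transpose_right: "A \<odot> smat_transpose B = smat_transpose (B \<odot> smat_transpose A)"
  by (simp add: smat_mult_def smat_transpose_def mult.commute)

section \<open>Polynomials in shift matrices\<close>

lemma smat_poly_apply: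
  "smat_poly P q A i j = (\<Sum>k\<le>degree q. coeff q k * (if k = 0 then P else smat_power A k) i j)"
proof -
  have "(\<Sum>k\<in>K. f k) i j = (\<Sum>k\<in>K. f k i j)" for f :: "nat \<Rightarrow> smat" and K
    by (induction K rule: infinite_finite_induct) auto
  then show ?thesis
    by (simp add: smat_poly_def smat_scale_def)
qed

text \<open>The assumption covers all three shifts at once: \<open>s k = k\<close> and
  \<open>c = 1\<close> for \<open>Lam\<close>; \<open>s k = 2 * k\<close> and \<open>c\<close> the
  indicator of a parity for \<open>Lam1\<close> and \<open>Lam2\<close>.\<close>

context
  fixes P A :: smat and s :: "nat \<Rightarrow> nat" and c :: "nat \<Rightarrow> real"
  assumes power: "\<And>k. (if k = 0 then P else smat_power A k) = (\<lambda>i l. if l = i + s k then c i else 0)"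
begin

lemma row_finite_smat_poly: "row_finite (smat_poly P q A)"
  by (rule row_finiteI[of "\<lambda>i. (\<lambda>k. i + s k) ` {..degree q}"])
    (auto simp: smat_poly_apply power intro!: sum.neutral)

lemma smat_poly_mult_apply:
  "(smat_poly P q A \<odot> B) i j = (\<Sum>k\<le>degree q. coeff q k * (c i * B (i + s k) j))"
proof -
  let ?N = "(\<lambda>k. i + s k) ` {..degree q}"
  have "(smat_poly P q A \<odot> B) i j = (\<Sum>l\<in>?N. smat_poly P q A i l * B l j)"
    by (rule smat_mult_eq_sum) (auto simp: smat_poly_apply power intro!: sum.neutral)
  \<comment> \<open>Keeping the indicator of \<open>l = i + s k\<close> lets the sums be swapped;
    each \<open>k\<close> then selects its single column, even if several \<open>k\<close> share
    one.\<close>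
  also have "\<dots> = (\<Sum>l\<in>?N. \<Sum>k\<le>degree q. if l = i + s k then coeff q k * (c i * B l j) else 0)"
    by (auto simp: smat_poly_apply power sum_distrib_right intro!: sum.cong)
  also have "\<dots> = (\<Sum>k\<le>degree q. \<Sum>l\<in>?N. if l = i + s k then coeff q k * (c i * B l j) else 0)"
    by (rule sum.swap)
  also have "\<dots> = (\<Sum>k\<le>degree q. coeff q k * (c i * B (i + s k) j))"
    by (intro sum.cong refl) (simp add: sum.delta')
  finally show ?thesis .
qed

end

section \<open>Explicit entries of the shift powers and derivation matrices\<close>

lemma smat_power_Lam: "smat_power Lam k = (\<lambda>i l. if l = i + k then 1 else 0)"
proof (induction k)
  case 0
  show ?case by (auto simp: smat_id_def smat_diag_def fun_eq_iff)
next
  case (Suc k)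
  have "(Lam \<odot> smat_power Lam k) i l = 1 * smat_power Lam k (Suc i) l" for i l
    by (rule smat_mult_single_row) (simp add: Lam_def)
  then show ?case by (simp add: Suc fun_eq_iff)
qed

lemma Lam_power: "(if k = 0 then smat_id else smat_power Lam k) = (\<lambda>i l. if l = i + k then 1 else 0)"
  using smat_power_Lam[of k] by (cases k) auto

text \<open>A shift by two preserves \<open>S\<close>, so the masks picked up along a power are all
  equal and, being 0 or 1, collapse to one. With \<open>P\<close> as zeroth power the formula also
  covers \<open>k = 0\<close>.\<close>

lemma smat_power_masked_Lam:
  fixes S :: "nat \<Rightarrow> bool"
  defines "P \<equiv> smat_diag (\<lambda>i. if S i then 1 else 0)"
  assumes S: "\<And>i. S (Suc (Suc i)) = S i"
  shows "(if k = 0 then P else smat_power (P \<odot> smat_power Lam 2) k)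
    = (\<lambda>i l. if l = i + 2 * k then (if S i then 1 else 0) else 0)"
proof -
  let ?c = "\<lambda>i. if S i then 1 else 0 :: real"
  let ?A = "P \<odot> smat_power Lam 2"
  have A: "?A i l = (if l = Suc (Suc i) then ?c i else 0)" for i l
    using smat_mult_single_row[of P i i "?c i" "smat_power Lam 2" l]
    unfolding smat_power_Lam P_def smat_diag_def by (auto split: if_splits)
  \<comment> \<open>The induction starts at exponent 1, because \<open>smat_power\<close> returns
    the identity rather than \<open>P\<close> at exponent 0.\<close>
  have "smat_power ?A (Suc k) = (\<lambda>i l. if l = i + 2 * Suc k then ?c i else 0)" for k
  proof (induction k)
    case 0
    have "(?A \<odot> smat_id) i l = ?c i * smat_id (Suc (Suc i)) l" for i l
      by (rule smat_mult_single_row) (simp add: A)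
    then show ?case by (auto simp: smat_id_def smat_diag_def fun_eq_iff)
  next
    case (Suc k)
    have "(?A \<odot> smat_power ?A (Suc k)) i l = ?c i * smat_power ?A (Suc k) (Suc (Suc i)) l" for i l
      by (rule smat_mult_single_row) (simp add: A)
    then show ?case unfolding Suc smat_power.simps(2)[of _ "Suc k"] by (auto simp: S fun_eq_iff)
  qed
  from this[of "k - 1"] show ?thesis
    by (cases k) (auto simp: P_def smat_diag_def fun_eq_iff)
qed

lemmas Lam1_power = smat_power_masked_Lam[of even, folded Proj1_def Lam1_def, simplified]
lemmas Lam2_power = smat_power_masked_Lam[of odd, folded Proj2_def Lam2_def, simplified]

text \<open>Row \<open>0\<close> of \<open>Der\<close> and rows \<open>0\<close> and \<open>1\<close> of \<open>Der1\<close> and \<open>Der2\<close> are zero, so the truncated column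
  indices \<open>i - 1\<close> and \<open>i - 2\<close> below do no harm.\<close>

lemma Der_apply: "Der i l = (if l = i - 1 then real i else 0)"
proof -
  have "Der i l = (\<Sum>k\<in>{l}. smat_transpose Lam i k * smat_diag (\<lambda>i. real (i + 1)) k l)"
    unfolding Der_def smat_mult_def by (rule suminf_finite) (auto simp: smat_diag_def)
  then show ?thesis by (auto simp: smat_transpose_def Lam_def smat_diag_def)
qed

lemma transpose_Lam_power2: "smat_power (smat_transpose Lam) 2 i l = (if i = l + 2 then 1 else 0)"
proof -
  let ?T = "smat_transpose Lam"
  have T: "(?T \<odot> B) i l = (if i = 0 then 0 else B (i - 1) l)" for B i l
    using smat_mult_single_row[of ?T i "i - 1" "if i = 0 then 0 else 1" B l]
    by (auto simp: smat_transpose_def Lam_def)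
  show ?thesis
    by (auto simp: numeral_2_eq_2 T smat_id_def smat_diag_def)
qed

lemma transpose_Lam_power2_diag:
  "(smat_power (smat_transpose Lam) 2 \<odot> smat_diag d) i l = (if i = l + 2 then d l else 0)"
proof -
  have "(smat_power (smat_transpose Lam) 2 \<odot> smat_diag d) i l
      = (\<Sum>k\<in>{l}. smat_power (smat_transpose Lam) 2 i k * smat_diag d k l)"
    unfolding smat_mult_def by (rule suminf_finite) (auto simp: smat_diag_def)
  then show ?thesis by (auto simp: transpose_Lam_power2 smat_diag_def)
qed

lemma Der1_apply: "Der1 i l = (if l = i - 2 then if even i then real (i div 2) else 0 else 0)"
  unfolding Der1_def transpose_Lam_power2_diag
  by (cases i rule: nat.exhaust; cases "i - 1") (auto elim!: evenE)

lemma Der2_apply: "Der2 i l = (if l = i - 2 then if odd i then real (i div 2) else 0 else 0)"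
  unfolding Der2_def transpose_Lam_power2_diag
  by (cases i rule: nat.exhaust; cases "i - 1") auto

section \<open>Integrating a derivative over an interval\<close>

text \<open>At a finite endpoint \<open>c\<close> the extra factor tends to \<open>c ^ m\<close>; at
  an infinite one it is absorbed by the quantifier over all powers.\<close>

lemma vanishes_at_boundary_power_mult:
  assumes "vanishes_at_boundary \<Delta> f"
  shows "vanishes_at_boundary \<Delta> (\<lambda>x. x ^ m * f x)"
proof -
  have "((\<lambda>x. x ^ m * f x) \<longlongrightarrow> c ^ m * 0) (at c within \<Delta>)" if "c \<in> frontier \<Delta>" for c
    using assms that by (intro tendsto_intros) (auto simp: vanishes_at_boundary_def)
  moreover have "(\<lambda>x. x ^ k * (x ^ m * f x)) = (\<lambda>x. x ^ (k + m) * f x)" for k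
    by (simp add: power_add mult.assoc)
  ultimately show ?thesis
    using assms by (simp add: vanishes_at_boundary_def del: mult_eq_0_iff)
qed

lemma tendsto_at_right_of_within:
  fixes f :: "real \<Rightarrow> real"
  assumes "(f \<longlongrightarrow> L) (at a within S)" "a < c" "{a<..<c} \<subseteq> S"
  shows "(f \<longlongrightarrow> L) (at_right a)"
proof -
  have "at_right a = at a within {a<..<c}"
    by (rule at_within_nhd[of _ "{..<c}"]) (use assms in auto)
  then show ?thesis
    using tendsto_within_subset[OF assms(1,3)] by simp
qed

lemma tendsto_at_left_of_within:
  fixes f :: "real \<Rightarrow> real"
  assumes "(f \<longlongrightarrow> L) (at b within S)" "c < b" "{c<..<b} \<subseteq> S"
  shows "(f \<longlongrightarrow> L) (at_left b)"
proof -
  have "at_left b = at b within {c<..<b}"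
    by (rule at_within_nhd[of _ "{c<..}"]) (use assms in auto)
  then show ?thesis
    using tendsto_within_subset[OF assms(1,3)] by simp
qed

text \<open>The endpoints form a null set, so the integral may be taken over the open interval,
  where the fundamental theorem of calculus gives the difference of two boundary limits, both
  zero.\<close>

lemma set_integral_derivative_eq_0:
  fixes F f :: "real \<Rightarrow> real"
  assumes \<Delta>: "is_interval \<Delta>"
    and F: "\<And>x. x \<in> interior \<Delta> \<Longrightarrow> (F has_field_derivative f x) (at x)"
    and f: "\<And>x. x \<in> interior \<Delta> \<Longrightarrow> isCont f x"
    and int: "set_integrable lborel \<Delta> f"
    and vanish: "vanishes_at_boundary \<Delta> F"
  shows "(LINT x:\<Delta>|lborel. f x) = 0"
proof -
  define a where "a = (INF x\<in>\<Delta>. ereal x)"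
  define b where "b = (SUP x\<in>\<Delta>. ereal x)"
  have bounds: "a \<le> ereal x" "ereal x \<le> b" if "x \<in> \<Delta>" for x
    using that by (auto simp: a_def b_def intro: INF_lower SUP_upper)
  have sub: "einterval a b \<subseteq> \<Delta>"
  proof
    fix x assume "x \<in> einterval a b"
    then obtain y z where "y \<in> \<Delta>" "z \<in> \<Delta>" "y < x" "x < z"
      by (auto simp: einterval_iff a_def b_def INF_less_iff less_SUP_iff)
    then show "x \<in> \<Delta>"
      using \<Delta> by (meson is_interval_1 less_imp_le)
  qed
  have sub_int: "einterval a b \<subseteq> interior \<Delta>"
    by (rule interior_maximal[OF sub]) simp
  have meas: "\<Delta> \<in> sets lborel"
    using \<Delta> by (simp add: real_interval_borel_measurable)
  \<comment> \<open>An infinite endpoint is sent to 0 by \<open>real_of_ereal\<close>; this only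
    enlarges a null set.\<close>
  have diff: "\<Delta> - einterval a b \<subseteq> {real_of_ereal a, real_of_ereal b}"
  proof
    fix x assume x: "x \<in> \<Delta> - einterval a b"
    then have "ereal x = a \<or> ereal x = b"
      using bounds[of x] by (auto simp: einterval_iff not_less)
    then show "x \<in> {real_of_ereal a, real_of_ereal b}"
      by (metis insertCI real_of_ereal.simps(1))
  qed
  have int': "set_integrable lborel (einterval a b) f"
    by (rule set_integrable_subset[OF int]) (use sub in auto)
  have "(LINT x:\<Delta>|lborel. f x) = (LINT x:einterval a b|lborel. f x)"
  proof (rule set_integral_cong_set)
    show "set_borel_measurable lborel (einterval a b) f" "set_borel_measurable lborel \<Delta> f"
      using int int' by (auto simp: set_integrable_def set_borel_measurable_def)
    have "AE x in lborel. x \<notin> {real_of_ereal a, real_of_ereal b}"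
      by (rule AE_not_in) (simp add: finite_imp_null_set_lborel)
    then show "AE x in lborel. x \<in> einterval a b \<longleftrightarrow> x \<in> \<Delta>"
      by eventually_elim (use sub diff in auto)
  qed
  also have "\<dots> = 0"
  proof (cases "a < b")
    case False
    then have "einterval a b = {}"
      by (auto simp: einterval_iff)
    then show ?thesis
      by (simp add: set_lebesgue_integral_def)
  next
    case True
    then obtain c where c: "a < ereal c" "ereal c < b"
      using einterval_nonempty by (auto simp: einterval_iff)
    \<comment> \<open>A finite endpoint is a frontier point: points between it and \<open>c\<close>
      approach it, and a ball around it inside \<Delta> would contain a point below the infimum. An
      infinite endpoint uses the boundary condition with power 0.\<close>
    have A: "((F \<circ> real_of_ereal) \<longlongrightarrow> 0) (at_right a)"
    proof (cases a)
      case (real r)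
      have "r < c" "{r<..<c} \<subseteq> \<Delta>"
        using c real sub less_trans[of "ereal _" "ereal c" b] by (auto simp: einterval_iff)
      moreover have "r \<in> closure \<Delta>"
        using closure_mono[OF \<open>{r<..<c} \<subseteq> \<Delta>\<close>] \<open>r < c\<close> by auto
      moreover have "r \<notin> interior \<Delta>"
      proof
        assume "r \<in> interior \<Delta>"
        then obtain e where e: "e > 0" "cball r e \<subseteq> \<Delta>"
          by (auto simp: mem_interior_cball)
        then have "r - e \<in> \<Delta>"
          by (auto simp: dist_real_def subset_iff)
        from bounds(1)[OF this] show False
          using real e by simp
      qed
      ultimately have "(F \<longlongrightarrow> 0) (at_right r)"
        using vanish by (intro tendsto_at_right_of_within[where S = \<Delta>])
          (auto simp: vanishes_at_boundary_def frontier_def)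
      then show ?thesis
        by (simp add: real ereal_tendsto_simps1)
    next
      case MInf
      have "\<not> bdd_below \<Delta>"
      proof
        assume "bdd_below \<Delta>"
        then obtain m where "\<And>x. x \<in> \<Delta> \<Longrightarrow> m \<le> x"
          by (auto simp: bdd_below_def)
        then have "ereal m \<le> a"
          unfolding a_def by (auto intro: INF_greatest)
        then show False
          using MInf by simp
      qed
      then have "\<forall>k. ((\<lambda>x. x ^ k * F x) \<longlongrightarrow> 0) at_bot"
        using vanish unfolding vanishes_at_boundary_def by metis
      from spec[OF this, of 0] show ?thesis
        by (simp add: MInf ereal_tendsto_simps1)
    qed (use True in auto)
    have B: "((F \<circ> real_of_ereal) \<longlongrightarrow> 0) (at_left b)"
    proof (cases b)
      case (real r)
      have "c < r" "{c<..<r} \<subseteq> \<Delta>"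
        using c real sub less_trans[of a "ereal c" "ereal _"] by (auto simp: einterval_iff)
      moreover have "r \<in> closure \<Delta>"
        using closure_mono[OF \<open>{c<..<r} \<subseteq> \<Delta>\<close>] \<open>c < r\<close> by auto
      moreover have "r \<notin> interior \<Delta>"
      proof
        assume "r \<in> interior \<Delta>"
        then obtain e where e: "e > 0" "cball r e \<subseteq> \<Delta>"
          by (auto simp: mem_interior_cball)
        then have "r + e \<in> \<Delta>"
          by (auto simp: dist_real_def subset_iff)
        from bounds(2)[OF this] show False
          using real e by simp
      qed
      ultimately have "(F \<longlongrightarrow> 0) (at_left r)"
        using vanish by (intro tendsto_at_left_of_within[where S = \<Delta>])
          (auto simp: vanishes_at_boundary_def frontier_def)
      then show ?thesis
        by (simp add: real ereal_tendsto_simps1)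
    next
      case PInf
      have "\<not> bdd_above \<Delta>"
      proof
        assume "bdd_above \<Delta>"
        then obtain m where "\<And>x. x \<in> \<Delta> \<Longrightarrow> x \<le> m"
          by (auto simp: bdd_above_def)
        then have "b \<le> ereal m"
          unfolding b_def by (auto intro: SUP_least)
        then show False
          using PInf by simp
      qed
      then have "\<forall>k. ((\<lambda>x. x ^ k * F x) \<longlongrightarrow> 0) at_top"
        using vanish unfolding vanishes_at_boundary_def by metis
      from spec[OF this, of 0] show ?thesis
        by (simp add: PInf ereal_tendsto_simps1)
    qed (use True in auto)
    have "(LBINT x=a..b. f x) = 0 - 0"
    proof (rule interval_integral_FTC_integrable[OF True _ _ int' A B])
      fix x assume "a < ereal x" "ereal x < b"
      then have x: "x \<in> interior \<Delta>"
        using sub_int by (auto simp: einterval_iff)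
      show "(F has_vector_derivative f x) (at x)"
        using F[OF x] by (simp add: has_real_derivative_iff_has_vector_derivative)
      show "isCont f x"
        using f[OF x] .
    qed
    then show ?thesis
      using True by (simp add: interval_lebesgue_integral_def less_imp_le)
  qed
  finally show ?thesis .
qed

section \<open>Moments and their recurrence\<close>

definition moment :: "real set \<Rightarrow> (real \<Rightarrow> real) \<Rightarrow> nat \<Rightarrow> real" where
  "moment \<Delta> u k = (LINT x:\<Delta>|lborel. x ^ k * u x)"

lemma moment_sum:
  assumes "finite_moments \<Delta> u" "finite K"
  shows "set_integrable lborel \<Delta> (\<lambda>x. \<Sum>k\<in>K. d k * (x ^ e k * u x))"
    and "(LINT x:\<Delta>|lborel. \<Sum>k\<in>K. d k * (x ^ e k * u x)) = (\<Sum>k\<in>K. d k * moment \<Delta> u (e k))"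
proof -
  have int: "set_integrable lborel \<Delta> (\<lambda>x. d k * (x ^ e k * u x))" for k
    using assms(1) by (simp add: finite_moments_def)
  show "set_integrable lborel \<Delta> (\<lambda>x. \<Sum>k\<in>K. d k * (x ^ e k * u x))"
    using int unfolding set_integrable_def scaleR_sum_right by (rule Bochner_Integration.integrable_sum)
  show "(LINT x:\<Delta>|lborel. \<Sum>k\<in>K. d k * (x ^ e k * u x)) = (\<Sum>k\<in>K. d k * moment \<Delta> u (e k))"
  proof -
    have "(LINT x:\<Delta>|lborel. \<Sum>k\<in>K. d k * (x ^ e k * u x))
        = (\<Sum>k\<in>K. LINT x:\<Delta>|lborel. d k * (x ^ e k * u x))"
      using int unfolding set_lebesgue_integral_def set_integrable_def scaleR_sum_right
      by (rule Bochner_Integration.integral_sum)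
    then show ?thesis
      by (simp add: moment_def)
  qed
qed

text \<open>The left side collects the terms in which the powers in
  \<open>x ^ m * poly \<sigma> x\<close> are differentiated, the right side those in which
  \<open>u\<close> is. For \<open>k + m = 0\<close> the truncated index is harmless, its factor
  being 0.\<close>

lemma moment_recurrence:
  assumes \<Delta>: "is_interval \<Delta>"
    and mom: "finite_moments \<Delta> u"
    and pearson: "pearson \<Delta> \<sigma> q u"
    and vanish: "vanishes_at_boundary \<Delta> (\<lambda>x. poly \<sigma> x * u x)"
  shows "(\<Sum>k\<le>degree \<sigma>. coeff \<sigma> k * (real (k + m) * moment \<Delta> u (k + m - 1)))
    = - (\<Sum>k\<le>degree q. coeff q k * moment \<Delta> u (k + m))"
proof -
  define f1 where "f1 x = (\<Sum>k\<le>degree \<sigma>. (coeff \<sigma> k * real (k + m)) * (x ^ (k + m - 1) * u x))" for x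
  define f2 where "f2 x = (\<Sum>k\<le>degree q. coeff q k * (x ^ (k + m) * u x))" for x
  note ints = moment_sum[OF mom finite_atMost]
  have int: "set_integrable lborel \<Delta> f1" "set_integrable lborel \<Delta> f2"
    unfolding f1_def f2_def by (rule ints(1))+
  have "(LINT x:\<Delta>|lborel. f1 x + f2 x) = 0"
  proof (rule set_integral_derivative_eq_0[OF \<Delta>])
    fix x assume "x \<in> interior \<Delta>"
    then have u: "(u has_field_derivative deriv u x) (at x)" and P: "poly \<sigma> x * deriv u x = poly q x * u x"
      using pearson by (auto simp: pearson_def DERIV_deriv_iff_field_differentiable)
    have p: "x ^ m * poly r x = (\<Sum>k\<le>degree r. coeff r k * x ^ (k + m))" for r and x :: real
      by (simp add: poly_altdef sum_distrib_left power_add mult_ac)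
    have "((\<lambda>x. (\<Sum>k\<le>degree \<sigma>. coeff \<sigma> k * x ^ (k + m)) * u x) has_field_derivative
        (\<Sum>k\<le>degree \<sigma>. coeff \<sigma> k * (real (k + m) * x ^ (k + m - 1))) * u x
        + deriv u x * (\<Sum>k\<le>degree \<sigma>. coeff \<sigma> k * x ^ (k + m))) (at x)"
      by (auto intro!: derivative_eq_intros u sum.cong)
    \<comment> \<open>The Pearson equation removes \<open>deriv u\<close>, so the whole derivative
      becomes a polynomial multiple of \<open>u\<close>: it is continuous in the interior and its
      integral is a combination of moments.\<close>
    also have "deriv u x * (\<Sum>k\<le>degree \<sigma>. coeff \<sigma> k * x ^ (k + m)) = x ^ m * poly q x * u x"
      using P by (simp flip: p) algebra
    also have "\<dots> = f2 x"
      by (simp add: p f2_def sum_distrib_right mult.assoc)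
    also have "(\<Sum>k\<le>degree \<sigma>. coeff \<sigma> k * (real (k + m) * x ^ (k + m - 1))) * u x = f1 x"
      by (simp add: f1_def sum_distrib_right mult.assoc)
    finally show "((\<lambda>x. x ^ m * (poly \<sigma> x * u x)) has_field_derivative f1 x + f2 x) (at x)"
      by (simp flip: p add: mult.assoc)
    show "isCont (\<lambda>x. f1 x + f2 x) x"
      unfolding f1_def f2_def by (intro continuous_intros DERIV_isCont[OF u])
  next
    show "set_integrable lborel \<Delta> (\<lambda>x. f1 x + f2 x)"
      using int by (rule set_integral_add)
    show "vanishes_at_boundary \<Delta> (\<lambda>x. x ^ m * (poly \<sigma> x * u x))"
      by (rule vanishes_at_boundary_power_mult[OF vanish])
  qed
  then have "(LINT x:\<Delta>|lborel. f1 x) + (LINT x:\<Delta>|lborel. f2 x) = 0"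
    by (simp add: set_integral_add(2)[OF int])
  then show ?thesis
    unfolding f1_def f2_def ints(2) by (simp add: mult.assoc)
qed

section \<open>Entrywise comparison of the two sides\<close>

lemma moment_matrix_apply:
  "moment_matrix \<Delta> u1 u2 i j = moment \<Delta> (if even j then u1 else u2) (i + j div 2)"
  by (simp add: moment_matrix_def moment_def Xvec_def X1vec_def X2vec_def power_add mult.assoc)

theorem theorem3:
  fixes \<Delta> :: "real set"
    and v w1 w2 wt1 wt2 :: "real \<Rightarrow> real"
    and \<sigma> q1 q2 :: "real poly"
    and g :: smat
  assumes "is_interval \<Delta>"
    and "wt1 = (\<lambda>x. w1 x * v x)"
    and "wt2 = (\<lambda>x. w2 x * v x)"
    and "finite_moments \<Delta> wt1"
    and "finite_moments \<Delta> wt2"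
    and "g = moment_matrix \<Delta> wt1 wt2"
    and "pearson \<Delta> \<sigma> q1 wt1"
    and "pearson \<Delta> \<sigma> q2 wt2"
    and "vanishes_at_boundary \<Delta> (\<lambda>x. poly \<sigma> x * wt1 x)"
    and "vanishes_at_boundary \<Delta> (\<lambda>x. poly \<sigma> x * wt2 x)"
  shows "smat_poly smat_id \<sigma> Lam \<odot> Der \<odot> g =
    - (g \<odot> smat_transpose
        (Der1 \<odot> smat_poly Proj1 \<sigma> Lam1 + smat_poly Proj1 q1 Lam1
          + Der2 \<odot> smat_poly Proj2 \<sigma> Lam2 + smat_poly Proj2 q2 Lam2))"
proof (intro ext)
  fix i j :: nat
  \<comment> \<open>The parity of the column \<open>j\<close> selects the weight, and
    \<open>n\<close> is the exponent that the column contributes.\<close>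
  define n where "n = j div 2"
  define u where "u = (if even j then wt1 else wt2)"
  define q where "q = (if even j then q1 else q2)"
  let ?M = "moment \<Delta> u"
  let ?T = "smat_transpose g"
  let ?S = "smat_poly smat_id \<sigma> Lam"
  let ?S1 = "smat_poly Proj1 \<sigma> Lam1" and ?Q1 = "smat_poly Proj1 q1 Lam1"
  let ?S2 = "smat_poly Proj2 \<sigma> Lam2" and ?Q2 = "smat_poly Proj2 q2 Lam2"
  note poly_mult = smat_poly_mult_apply[OF Lam_power] smat_poly_mult_apply[OF Lam1_power]
    smat_poly_mult_apply[OF Lam2_power]
  note [simp] = smat_mult_single_row[OF Der_apply] smat_mult_single_row[OF Der1_apply]
    smat_mult_single_row[OF Der2_apply]
  note fin = row_finite_smat_poly[OF Lam_power] row_finite_smat_poly[OF Lam1_power]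
    row_finite_smat_poly[OF Lam2_power] row_finite_single_row[OF Der_apply]
    row_finite_single_row[OF Der1_apply] row_finite_single_row[OF Der2_apply]
  have g: "g i' j' = moment \<Delta> (if even j' then wt1 else wt2) (i' + j' div 2)" for i' j'
    using assms(6) by (simp add: moment_matrix_apply)
  have rec: "(\<Sum>k\<le>degree \<sigma>. coeff \<sigma> k * (real (k + (i + n)) * ?M (k + (i + n) - 1)))
      = - (\<Sum>k\<le>degree q. coeff q k * ?M (k + (i + n)))"
    using assms by (intro moment_recurrence) (auto simp: u_def q_def)
  have "(?S \<odot> Der \<odot> g) i j = (\<Sum>k\<le>degree \<sigma>. coeff \<sigma> k * (real (i + k) * ?M (i + k - 1 + n)))"
    by (simp add: smat_mult_assoc fin poly_mult g u_def n_def)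
  \<comment> \<open>Truncated subtraction makes the two indices differ only when
    \<open>i + k = 0\<close> and \<open>n > 0\<close>, and then the factor
    \<open>real (i + k)\<close> is 0.\<close>
  also have "\<dots> = (\<Sum>k\<le>degree \<sigma>. coeff \<sigma> k * (real (i + k) * ?M (k + (i + n) - 1)))"
  proof (intro sum.cong refl)
    fix k
    show "coeff \<sigma> k * (real (i + k) * ?M (i + k - 1 + n))
        = coeff \<sigma> k * (real (i + k) * ?M (k + (i + n) - 1))"
      by (cases "i + k = 0") (auto simp: algebra_simps)
  qed
  finally have lhs: "(?S \<odot> Der \<odot> g) i j = \<dots>" .
  \<comment> \<open>Moving two columns back keeps the parity and lowers the exponent by one. For
    \<open>j < 2\<close> the index \<open>j - 2\<close> is truncated, but then
    \<open>n = 0\<close>.\<close>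
  have sigma: "real n * (\<Sum>k\<le>degree \<sigma>. coeff \<sigma> k * g i (j - 2 + 2 * k))
      = (\<Sum>k\<le>degree \<sigma>. coeff \<sigma> k * (real n * ?M (k + (i + n) - 1)))"
  proof (cases "n = 0")
    case False
    then obtain p where p: "j = p + 2"
      by (metis n_def add.commute div_less le_Suc_ex not_less)
    have "(p + 2 * k) div 2 = p div 2 + k" "n = Suc (p div 2)" for k
      by (simp_all add: n_def p)
    then have "g i (j - 2 + 2 * k) = ?M (k + (i + n) - 1)" for k
      by (simp add: g u_def p add.commute add.left_commute)
    then show ?thesis
      by (simp add: sum_distrib_left mult_ac)
  qed simp
  have "(g \<odot> smat_transpose (Der1 \<odot> ?S1 + ?Q1 + Der2 \<odot> ?S2 + ?Q2)) i j
      = ((Der1 \<odot> ?S1 + ?Q1 + Der2 \<odot> ?S2 + ?Q2) \<odot> ?T) j i"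
    by (subst smat_mult_transpose_right) (simp add: smat_transpose_def)
  also have "\<dots> = (Der1 \<odot> (?S1 \<odot> ?T) + ?Q1 \<odot> ?T + Der2 \<odot> (?S2 \<odot> ?T) + ?Q2 \<odot> ?T) j i"
    by (simp add: smat_mult_add_left smat_mult_assoc row_finite_add row_finite_mult fin)
  \<comment> \<open>In row \<open>j\<close> only the two terms belonging to the parity of
    \<open>j\<close> survive.\<close>
  also have "\<dots> = real n * (\<Sum>k\<le>degree \<sigma>. coeff \<sigma> k * g i (j - 2 + 2 * k))
      + (\<Sum>k\<le>degree q. coeff q k * g i (j + 2 * k))"
    by (simp add: poly_mult q_def n_def smat_transpose_def)
  also have "\<dots> = (\<Sum>k\<le>degree \<sigma>. coeff \<sigma> k * (real n * ?M (k + (i + n) - 1)))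
      + (\<Sum>k\<le>degree q. coeff q k * ?M (k + (i + n)))"
    unfolding sigma by (simp add: g u_def n_def algebra_simps)
  finally have rhs: "(g \<odot> smat_transpose (Der1 \<odot> ?S1 + ?Q1 + Der2 \<odot> ?S2 + ?Q2)) i j = \<dots>" .
  \<comment> \<open>The factors \<open>i + k\<close> from the left side and \<open>n\<close> from
    the right side add up to the factor \<open>k + (i + n)\<close> of \<open>rec\<close>.\<close>
  show "(?S \<odot> Der \<odot> g) i j = (- (g \<odot> smat_transpose (Der1 \<odot> ?S1 + ?Q1 + Der2 \<odot> ?S2 + ?Q2))) i j"
    unfolding uminus_apply lhs rhs using rec by (simp add: distrib_left distrib_right sum.distrib)
qed

end
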